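(* Let $\Theta^*=(\mathbf C^*,\mathbf B^*,\mathbf r^*,\omega_0^{2*})$ be an admissible (true) parameter. Assume: (a) all eigenvalues of $\boldsymbol\Sigma^*=(\mathbf I-\mathbf C^* )^{-T}\omega_0^{2*}(\mathbf I-\mathbf C^* )^{-1}$ are finite and greater than a constant $\eta_{\boldsymbol\Sigma^*}>0$, and $r_{jl}^{*2}<\infty$ for all $j,l$; (b) $K_j<T$ for all $j=1,\dots,P$. Let $\mathfrak D=\{\Theta \text{ admissible}: \boldsymbol\Sigma_{\mathbf Y}(\Theta)=\boldsymbol\Sigma_{\mathbf Y}(\Theta^* )\}$ be the equivalence class of $\Theta^*$. Then for every $\Theta^e=(\mathbf C,\mathbf B,\mathbf r,\omega_0^2)\in\mathfrak D$ there exist orthogonal matrices $\mathbf Q_j\in\mathbb R^{K_j\times K_j}$, $j=1,\dots,P$ (that is, $\mathbf Q_j^T\mathbf Q_j=\mathbf Q_j\mathbf Q_j^T=\mathbf I$), such that for all $j,j'\in\{1,\dots,P\}$, $l\in\{1,\dots,L_j\}$, $l'\in\{1,\dots,L_{j'}\}$: $$\mathbf B_j=\mathbf B_j^*\mathbf Q_j,\qquad r_{jl}^2=r_{jl}^{*2},\qquad \omega_0^2=\omega_0^{2*},\qquad \mathbf C_{j'jl'l}=\mathbf Q_{j'}^T\,\mathbf C^*_{j'jl'l}\,\mathbf Q_j .$$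
   Context: Fix positive integers $P$, $T$, $L_j$, $K_j$ ($j=1,\dots,P$) and let $M=\sum_{j=1}^P L_jK_j$. An admissible parameter is $\Theta=(\mathbf C,\mathbf B,\mathbf r,\omega_0^2)$ where: - $\mathbf C\in\mathbb R^{M\times M}$ is partitioned into blocks $\mathbf C_{ij}\in\mathbb R^{L_iK_i\times L_jK_j}$ ($i,j=1,\dots,P$), each of the form $\mathbf C_{ij}=\mathbf C^L_{ij}\otimes\mathbf C^K_{ij}$ (Kronecker product) with $\mathbf C^L_{ij}\in\mathbb R^{L_i\times L_j}$, $\mathbf C^K_{ij}\in\mathbb R^{K_i\times K_j}$ (possibly zero), and the directed graph on $\{1,\dots,P\}$ with an edge $i\to j$ iff $\mathbf C_{ij}\ne\mathbf 0$ is acyclic (in particular $\mathbf C_{jj}=\mathbf 0$); - $\mathbf B=(\mathbf B_1,\dots,\mathbf B_P)$ with $\mathbf B_j\in\mathbb R^{T\times K_j}$, $\mathbf B_j^T\mathbf B_j=\mathbf I$; - $\mathbf r=(r_{jl}^2)_{1\le j\le P,\,1\le l\le L_j}$ with $r_{jl}^2>0$; and $\omega_0^2>0$. $\mathbf C_{j'jl'l}\in\mathbb R^{K_{j'}\times K_j}$ is the $(l',l)$ sub-block of $\mathbf C_{j'j}$. For an $M\times M$ matrix $\mathbf S$, $[\mathbf S]_{jl,j'l'}\in\mathbb R^{K_j\times K_{j'}}$ denotes its sub-block with rows indexed by function $l$ of node $j$ and columns by function $l'$ of node $j'$. Model under $\Theta$: $\mathbf x=\mathbf C^T\mathbf x+\boldsymbol\xi$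 with $\boldsymbol\xi\sim\mathcal N(\mathbf 0,\omega_0^2\mathbf I_M)$, and $\mathbf Y_{jl}=\mathbf B_j\mathbf x_{jl}+\boldsymbol\varepsilon_{jl}\in\mathbb R^T$ with independent $\boldsymbol\varepsilon_{jl}\sim\mathcal N(\mathbf 0,r_{jl}^2\mathbf I_T)$, where $\mathbf x_{jl}\in\mathbb R^{K_j}$ is the part of $\mathbf x\in\mathbb R^M$ belonging to function $l$ of node $j$. The covariance $\boldsymbol\Sigma_{\mathbf Y}(\Theta)$ of $\mathbf Y=(\mathbf Y_{jl})_{j,l}$ therefore has blocks $$\boldsymbol\Sigma_{\mathbf Y}(\Theta)_{jl,j'l'}=\begin{cases}\mathbf B_j[(\mathbf I-\mathbf C)^{-T}\omega_0^2(\mathbf I-\mathbf C)^{-1}]_{jl,jl}\mathbf B_j^T+r_{jl}^2\mathbf I_T,&(j,l)=(j',l'),\\ \mathbf B_j[(\mathbf I-\mathbf C)^{-T}\omega_0^2(\mathbf I-\mathbf C)^{-1}]_{jl,j'l'}\mathbf B_{j'}^T,&\text{otherwise.}\end{cases}$$ *)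

theory Defs
  imports
    Complex_Main
    "Jordan_Normal_Form.Char_Poly"
    "Jordan_Normal_Form.Gauss_Jordan_Elimination"
begin

text \<open>Nodes, functions of a node and coordinates are all counted from 0, so the dimension
  parameters are used as: nodes \<open>j < P\<close>, functions \<open>l < L j\<close>, basis coefficients \<open>k < K j\<close>,
  time points \<open>t < T\<close>.\<close>

definition kron_mat :: "'a::times mat \<Rightarrow> 'a mat \<Rightarrow> 'a mat" where
  "kron_mat A B = mat (dim_row A * dim_row B) (dim_col A * dim_col B)
     (\<lambda>(i, j). A $$ (i div dim_row B, j div dim_col B) * B $$ (i mod dim_row B, j mod dim_col B))"

text \<open>If consecutive blocks have sizes \<open>d 0, d 1, \<dots>\<close>, then \<open>offset d j\<close> is the position at which
  block \<open>j\<close> starts, and \<open>block_at d p\<close> is the block that contains position \<open>p\<close>.\<close>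

definition offset :: "(nat \<Rightarrow> nat) \<Rightarrow> nat \<Rightarrow> nat" where
  "offset d j = (\<Sum>i<j. d i)"

definition block_at :: "(nat \<Rightarrow> nat) \<Rightarrow> nat \<Rightarrow> nat" where
  "block_at d p = (LEAST j. p < offset d (Suc j))"

text \<open>The coordinates of \<open>x\<close> are ordered lexicographically by (node, function, coefficient); this
  is the order under which a Kronecker product of an \<open>L i \<times> L j\<close> by a \<open>K i \<times> K j\<close> matrix is an
  \<open>(i, j)\<close> block.\<close>

definition x_dim :: "nat \<Rightarrow> (nat \<Rightarrow> nat) \<Rightarrow> (nat \<Rightarrow> nat) \<Rightarrow> nat" where
  "x_dim P L K = (\<Sum>j<P. L j * K j)"

definition node_offset :: "(nat \<Rightarrow> nat) \<Rightarrow> (nat \<Rightarrow> nat) \<Rightarrow> nat \<Rightarrow> nat" where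
  "node_offset L K j = offset (\<lambda>i. L i * K i) j"

definition node_block ::
  "(nat \<Rightarrow> nat) \<Rightarrow> (nat \<Rightarrow> nat) \<Rightarrow> 'a mat \<Rightarrow> nat \<Rightarrow> nat \<Rightarrow> 'a mat" where
  "node_block L K S i j = mat (L i * K i) (L j * K j)
     (\<lambda>(a, b). S $$ (node_offset L K i + a, node_offset L K j + b))"

text \<open>\<open>fun_block L K S j l j' l'\<close> is \<open>[S]\<close> with row index \<open>jl\<close> and column index \<open>j'l'\<close>.\<close>

definition fun_block ::
  "(nat \<Rightarrow> nat) \<Rightarrow> (nat \<Rightarrow> nat) \<Rightarrow> 'a mat \<Rightarrow> nat \<Rightarrow> nat \<Rightarrow> nat \<Rightarrow> nat \<Rightarrow> 'a mat" where
  "fun_block L K S j l j' l' = mat (K j) (K j')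
     (\<lambda>(a, b). S $$ (node_offset L K j + l * K j + a, node_offset L K j' + l' * K j' + b))"

text \<open>The fields \<open>noise_var\<close> and \<open>innov_var\<close> hold the variances \<open>r\<^sub>j\<^sub>l\<^sup>2\<close> and \<open>\<omega>\<^sub>0\<^sup>2\<close> themselves, not
  their square roots.\<close>

record param =
  coef :: "real mat"
  basis :: "nat \<Rightarrow> real mat"
  noise_var :: "nat \<Rightarrow> nat \<Rightarrow> real"
  innov_var :: real

definition node_graph ::
  "nat \<Rightarrow> (nat \<Rightarrow> nat) \<Rightarrow> (nat \<Rightarrow> nat) \<Rightarrow> real mat \<Rightarrow> (nat \<times> nat) set" where
  "node_graph P L K C =
     {(i, j). i < P \<and> j < P \<and> node_block L K C i j \<noteq> 0\<^sub>m (L i * K i) (L j * K j)}"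

definition admissible ::
  "nat \<Rightarrow> nat \<Rightarrow> (nat \<Rightarrow> nat) \<Rightarrow> (nat \<Rightarrow> nat) \<Rightarrow> param \<Rightarrow> bool" where
  "admissible P T L K \<Theta> \<longleftrightarrow>
     coef \<Theta> \<in> carrier_mat (x_dim P L K) (x_dim P L K) \<and>
     (\<forall>i<P. \<forall>j<P. \<exists>CL \<in> carrier_mat (L i) (L j). \<exists>CK \<in> carrier_mat (K i) (K j).
        node_block L K (coef \<Theta>) i j = kron_mat CL CK) \<and>
     acyclic (node_graph P L K (coef \<Theta>)) \<and>
     (\<forall>j<P. basis \<Theta> j \<in> carrier_mat T (K j) \<and>
        transpose_mat (basis \<Theta> j) * basis \<Theta> j = 1\<^sub>m (K j)) \<and>
     (\<forall>j<P. \<forall>l<L j. noise_var \<Theta> j l > 0) \<and>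
     innov_var \<Theta> > 0"

text \<open>\<open>(I - C)\<^sup>-\<^sup>T \<omega>\<^sub>0\<^sup>2 (I - C)\<^sup>-\<^sup>1\<close>. For an admissible parameter \<open>I - C\<close> is invertible, because \<open>C\<close> is
  nilpotent, so that \<open>mat_inverse\<close> does not return \<open>None\<close>.\<close>

definition cov_x :: "nat \<Rightarrow> (nat \<Rightarrow> nat) \<Rightarrow> (nat \<Rightarrow> nat) \<Rightarrow> param \<Rightarrow> real mat" where
  "cov_x P L K \<Theta> =
     (let W = the (mat_inverse (1\<^sub>m (x_dim P L K) - coef \<Theta>))
      in innov_var \<Theta> \<cdot>\<^sub>m (transpose_mat W * W))"

definition cov_Y_block ::
  "nat \<Rightarrow> nat \<Rightarrow> (nat \<Rightarrow> nat) \<Rightarrow> (nat \<Rightarrow> nat) \<Rightarrow> param \<Rightarrow> nat \<Rightarrow> nat \<Rightarrow> nat \<Rightarrow> nat \<Rightarrow> real mat" where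
  "cov_Y_block P T L K \<Theta> j l j' l' =
     (let S = basis \<Theta> j * fun_block L K (cov_x P L K \<Theta>) j l j' l' * transpose_mat (basis \<Theta> j')
      in if (j, l) = (j', l') then S + noise_var \<Theta> j l \<cdot>\<^sub>m 1\<^sub>m T else S)"

text \<open>The covariance matrix of the stacked vector \<open>Y\<close>, whose coordinates are ordered
  lexicographically by (node, function, time).\<close>

definition cov_Y ::
  "nat \<Rightarrow> nat \<Rightarrow> (nat \<Rightarrow> nat) \<Rightarrow> (nat \<Rightarrow> nat) \<Rightarrow> param \<Rightarrow> real mat" where
  "cov_Y P T L K \<Theta> =
     (let d = (\<lambda>j. L j * T) in
      mat (\<Sum>j<P. L j * T) (\<Sum>j<P. L j * T)
        (\<lambda>(p, q).
          let j = block_at d p; u = p - offset d j; j' = block_at d q; v = q - offset d j'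
          in cov_Y_block P T L K \<Theta> j (u div T) j' (v div T) $$ (u mod T, v mod T)))"

definition equiv_class ::
  "nat \<Rightarrow> nat \<Rightarrow> (nat \<Rightarrow> nat) \<Rightarrow> (nat \<Rightarrow> nat) \<Rightarrow> param \<Rightarrow> param set" where
  "equiv_class P T L K \<Theta>' =
     {\<Theta>. admissible P T L K \<Theta> \<and> cov_Y P T L K \<Theta> = cov_Y P T L K \<Theta>'}"

lemma offset_mono: "i \<le> j \<Longrightarrow> offset d i \<le> offset d j"
  unfolding offset_def by (rule sum_mono2) auto

lemma block_at_offset:
  assumes "u < d j"
  shows "block_at d (offset d j + u) = j"
  unfolding block_at_def
proof (rule Least_equality)
  show "offset d j + u < offset d (Suc j)"
    using assms by (simp add: offset_def)
next
  fix i assume "offset d j + u < offset d (Suc i)"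
  then show "j \<le> i"
    using offset_mono[of "Suc i" j d] by (cases "j \<le> i") auto
qed

lemma mult_add_less:
  fixes l n t m :: nat
  assumes "l < n" "t < m"
  shows "l * m + t < n * m"
proof -
  have "l * m + t < Suc l * m" using assms by simp
  also have "\<dots> \<le> n * m" using assms by (intro mult_le_mono1) simp
  finally show ?thesis .
qed

lemma offset_less_total:
  assumes "j < P" "u < d j"
  shows "offset d j + u < (\<Sum>i<P. d i)"
proof -
  have "offset d j + u < offset d (Suc j)" using assms by (simp add: offset_def)
  also have "\<dots> \<le> offset d P" using assms by (intro offset_mono) simp
  finally show ?thesis by (simp add: offset_def)
qed

lemma cov_Y_index:
  fixes L :: "nat \<Rightarrow> nat" and T :: nat
  defines "d \<equiv> \<lambda>j. L j * T"
  assumes "j < P" "l < L j" "t < T" "j' < P" "l' < L j'" "t' < T"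
  shows "cov_Y P T L K \<Theta> $$ (offset d j + (l * T + t), offset d j' + (l' * T + t')) =
    cov_Y_block P T L K \<Theta> j l j' l' $$ (t, t')"
proof -
  have u: "l * T + t < d j" and v: "l' * T + t' < d j'"
    using assms by (auto simp: d_def intro: mult_add_less)
  have N: "(\<Sum>j<P. L j * T) = (\<Sum>j<P. d j)" by (simp add: d_def)
  show ?thesis
    using assms(2-) block_at_offset[of _ d, OF u] block_at_offset[of _ d, OF v]
      offset_less_total[of _ P _ d, OF \<open>j < P\<close> u] offset_less_total[of _ P _ d, OF \<open>j' < P\<close> v]
    unfolding cov_Y_def Let_def N d_def[symmetric] by simp
qed

end

theory Submission
  imports Defs
begin

text \<open>Since \<open>K j < T\<close>, some nonzero vector is orthogonal to the columns of \<open>B\<^sub>j\<close>; testing the diagonal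
  blocks of the covariance against it gives \<open>r\<^sub>j\<^sub>l\<^sup>2\<close>. Once the noise is removed, \<open>B\<^sub>j\<close> and \<open>B\<^sup>*\<^sub>j\<close> have the
  same column space, so \<open>Q\<^sub>j = B\<^sup>*\<^sub>j\<^sup>T B\<^sub>j\<close> is orthogonal, and the covariance of \<open>x\<close> is conjugated by the
  block diagonal matrix \<open>R\<close> of the \<open>Q\<^sub>j\<close>. Passing to inverses,
  \<open>A A\<^sup>T / \<omega>\<^sub>0\<^sup>2 = D D\<^sup>T / \<omega>\<^sub>0\<^sup>*\<^sup>2\<close> with \<open>A = I - C\<close> and \<open>D = I - R\<^sup>T C\<^sup>* R\<close>. Both \<open>A\<close> and \<open>D\<close> have unit
  diagonal, so the diagonal entries of the two sides are at least \<open>1 / \<omega>\<^sub>0\<^sup>2\<close> and \<open>1 / \<omega>\<^sub>0\<^sup>*\<^sup>2\<close>, with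
  equality at the sinks of the respective graphs: the variances agree. Finally a sink \<open>s\<close> of \<open>A\<close> is one of
  \<open>D\<close>, because a diagonal entry 1 forces a zero row; row \<open>s\<close> of the common Gram matrix is then column \<open>s\<close>
  of both \<open>A\<close> and \<open>D\<close>, and induction on the remaining coordinates gives \<open>A = D\<close>.\<close>

section \<open>Sinks of acyclic graphs and Gram matrices of factors with unit diagonal\<close>

text \<open>The converse of a finite acyclic relation is well-founded, and a minimal element of the
  image of \<open>S\<close> under \<open>f\<close> is a sink. The map \<open>f\<close> will send
  coordinates to their nodes.\<close>

lemma finite_acyclic_sink:
  assumes "finite r" "acyclic r" "S \<noteq> {}"
  obtains p where "p \<in> S" "\<And>q. q \<in> S \<Longrightarrow> (f p, f q) \<notin> r"
proof -
  obtain i where i: "i \<in> f ` S" and s: "\<And>k. (k, i) \<in> r\<inverse> \<Longrightarrow> k \<notin> f ` S"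
    using wfE_min'[OF finite_acyclic_wf_converse[OF assms(1,2)], of "f ` S"] assms(3) by blast
  then obtain p where p: "p \<in> S" "i = f p" by blast
  show thesis
    using that[OF p(1)] s p(2) by blast
qed

text \<open>Induction that strips off a sink \<open>s\<close> of \<open>A\<close>: row
  \<open>s\<close> of \<open>A\<close> is a unit vector, hence so is row \<open>s\<close> of
  \<open>B\<close>, and column \<open>s\<close> of each factor can then be read off the Gram matrix.
  The sink condition on all subsets \<open>U\<close> is a form of triangularity that passes to
  \<open>S - {s}\<close>, so no ordering has to be chosen.\<close>

lemma gram_unit_diagonal_unique:
  fixes A B :: "'a \<Rightarrow> 'a \<Rightarrow> real"
  assumes "finite S"
    and "\<And>U. U \<subseteq> S \<Longrightarrow> U \<noteq> {} \<Longrightarrow> \<exists>p\<in>U. \<forall>q\<in>U. q \<noteq> p \<longrightarrow> A p q = 0"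
    and "\<And>p. p \<in> S \<Longrightarrow> A p p = 1" and "\<And>p. p \<in> S \<Longrightarrow> B p p = 1"
    and "\<And>p q. p \<in> S \<Longrightarrow> q \<in> S \<Longrightarrow> (\<Sum>k\<in>S. A p k * A q k) = (\<Sum>k\<in>S. B p k * B q k)"
    and "p \<in> S" "q \<in> S"
  shows "A p q = B p q"
  using assms
proof (induction "card S" arbitrary: S p q)
  case 0
  then show ?case by auto
next
  case (Suc n S)
  obtain s where s: "s \<in> S" "\<And>q. q \<in> S \<Longrightarrow> q \<noteq> s \<Longrightarrow> A s q = 0"
    using Suc.prems(2)[of S] Suc.prems(6) by blast
  have split: "(\<Sum>k\<in>S. f k) = f s + (\<Sum>k\<in>S - {s}. f k)" for f :: "'a \<Rightarrow> real"
    using Suc.prems(1) s(1) by (simp add: sum.remove)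
  have "(\<Sum>k\<in>S - {s}. A s k * A s k) = 0" using s(2) by (intro sum.neutral) auto
  \<comment> \<open>The Gram entries at \<open>(s, s)\<close> agree and each unit diagonal already
    contributes 1, so nothing is left for the other squares in row \<open>s\<close> of
    \<open>B\<close>.\<close>
  then have "(\<Sum>k\<in>S - {s}. B s k * B s k) = 0"
    using Suc.prems(5)[OF s(1) s(1)] Suc.prems(3,4)[OF s(1)] by (simp add: split)
  then have Bs: "B s k = 0" if "k \<in> S" "k \<noteq> s" for k
    using that Suc.prems(1) by (simp add: sum_nonneg_eq_0_iff)
  have col: "A k s = B k s" if "k \<in> S" for k
  proof -
    have "(\<Sum>i\<in>S - {s}. A k i * A s i) = 0" "(\<Sum>i\<in>S - {s}. B k i * B s i) = 0"
      using s(2) Bs by (auto intro!: sum.neutral)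
    then show ?thesis
      using Suc.prems(5)[OF that s(1)] Suc.prems(3,4)[OF s(1)] by (simp add: split)
  qed
  have rest: "A p q = B p q" if "p \<in> S - {s}" "q \<in> S - {s}" for p q
  proof (rule Suc.hyps(1)[OF _ _ _ _ _ _ that])
    show "n = card (S - {s})" using Suc.hyps(2) Suc.prems(1) s(1) by simp
    show "finite (S - {s})" using Suc.prems(1) by simp
    show "\<exists>p\<in>U. \<forall>q\<in>U. q \<noteq> p \<longrightarrow> A p q = 0" if "U \<subseteq> S - {s}" "U \<noteq> {}" for U
      using that Suc.prems(2)[of U] by blast
    \<comment> \<open>By \<open>col\<close>, column \<open>s\<close> contributes the same product to
      both sides, so deleting it preserves the Gram identity.\<close>
    show "(\<Sum>k\<in>S - {s}. A p k * A q k) = (\<Sum>k\<in>S - {s}. B p k * B q k)"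
      if "p \<in> S - {s}" "q \<in> S - {s}" for p q
      using Suc.prems(5)[of p q] that col by (simp add: split)
  qed (use Suc.prems in auto)
  show ?case
    using rest[of p q] col[of p] s Bs Suc.prems by (cases "q = s"; cases "p = s") auto
qed

section \<open>Matrix products, Gram matrices and kernels\<close>

lemma index_mult_mat_sum:
  assumes "A \<in> carrier_mat m n" "B \<in> carrier_mat n k" "i < m" "j < k"
  shows "(A * B) $$ (i, j) = (\<Sum>q<n. A $$ (i, q) * B $$ (q, j))"
  using assms by (auto simp: scalar_prod_def atLeast0LessThan intro!: sum.cong)

text \<open>With side conditions on dimensions alone, associativity can be used as a rewrite rule
  that moves all brackets to the right.\<close>

lemma mult_assoc_dim:
  assumes "dim_col A = dim_row B" "dim_col B = dim_row C"
  shows "A * B * C = A * (B * C)"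
  using assms by (intro assoc_mult_mat[of A "dim_row A" "dim_col A" B "dim_col B" C "dim_col C"]) auto

lemma gram_index_nonneg:
  fixes X :: "real mat"
  assumes "X \<in> carrier_mat n k" "i < k"
  shows "0 \<le> (transpose_mat X * X) $$ (i, i)"
  using assms by (subst index_mult_mat_sum[of _ k n _ k]) (auto intro!: sum_nonneg)

text \<open>The diagonal entries of \<open>transpose_mat X * X\<close> are the squared norms of the
  columns of \<open>X\<close>.\<close>

lemma gram_eq_0_imp:
  fixes X :: "real mat"
  assumes X: "X \<in> carrier_mat n k" and "transpose_mat X * X = 0\<^sub>m k k"
  shows "X = 0\<^sub>m n k"
proof (rule eq_matI)
  fix i j assume ij: "i < dim_row (0\<^sub>m n k :: real mat)" "j < dim_col (0\<^sub>m n k :: real mat)"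
  have "(\<Sum>q<n. X $$ (q, j) * X $$ (q, j)) = (transpose_mat X * X) $$ (j, j)"
    using X ij by (subst index_mult_mat_sum[of _ k n _ k]) auto
  also have "\<dots> = 0" using assms(2) ij by simp
  finally show "X $$ (i, j) = 0\<^sub>m n k $$ (i, j)"
    using ij by (simp add: sum_nonneg_eq_0_iff)
qed (use X in auto)

text \<open>Zero rows appended to \<open>A\<close> give a singular square matrix with the same
  kernel. The kernel vector is returned as a one-column matrix so that later computations remain
  products of matrices.\<close>

lemma wide_mat_kernel:
  fixes A :: "'a::field mat"
  assumes A: "A \<in> carrier_mat k n" and "k < n"
  obtains V where "V \<in> carrier_mat n 1" "V \<noteq> 0\<^sub>m n 1" "A * V = 0\<^sub>m k 1"
proof -
  define A' where "A' = mat n n (\<lambda>(i, j). if i < k then A $$ (i, j) else 0)"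
  have A': "A' \<in> carrier_mat n n" by (simp add: A'_def)
  have "A' = mat\<^sub>r n n (\<lambda>i. if i = k then 0\<^sub>v n else row A' i)"
    using \<open>k < n\<close> by (intro eq_matI) (auto simp: A'_def)
  also have "det \<dots> = 0"
    using \<open>k < n\<close> A' by (intro det_row_0) auto
  finally have "det A' = 0" .
  then obtain v where v: "v \<in> carrier_vec n" "v \<noteq> 0\<^sub>v n" "A' *\<^sub>v v = 0\<^sub>v n"
    using det_0_iff_vec_prod_zero_field[OF A'] by blast
  define V where "V = mat n 1 (\<lambda>(i, _). v $ i)"
  show thesis
  proof
    show V: "V \<in> carrier_mat n 1" by (simp add: V_def)
    show "V \<noteq> 0\<^sub>m n 1"
    proof
      assume V0: "V = 0\<^sub>m n 1"
      have "v $ i = 0" if "i < n" for i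
        using arg_cong[OF V0, of "\<lambda>M. M $$ (i, 0)"] that by (simp add: V_def)
      then show False using v(1,2) by auto
    qed
    show "A * V = 0\<^sub>m k 1"
    proof (rule eq_matI)
      fix i j assume ij: "i < dim_row (0\<^sub>m k 1 :: 'a mat)" "j < dim_col (0\<^sub>m k 1 :: 'a mat)"
      have "(A * V) $$ (i, j) = (\<Sum>q<n. A $$ (i, q) * v $ q)"
        using ij by (subst index_mult_mat_sum[OF A V]) (auto simp: V_def)
      also have "\<dots> = (A' *\<^sub>v v) $ i"
        using ij \<open>k < n\<close> v(1) by (auto simp: A'_def scalar_prod_def atLeast0LessThan)
      also have "\<dots> = 0" using v(3) ij \<open>k < n\<close> by simp
      finally show "(A * V) $$ (i, j) = 0\<^sub>m k 1 $$ (i, j)" using ij by simp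
    qed (use A V in auto)
  qed
qed

section \<open>Recovering noise, basis and precision from covariances\<close>

text \<open>A nonzero vector \<open>V\<close> orthogonal to the columns of \<open>B\<close> sees
  only the noise on the left of \<open>eq\<close>, while on the right the signal adds a nonnegative
  square. Exchanging the two sides will give equality of the variances.\<close>

lemma low_rank_noise_le:
  fixes B B' X X' :: "real mat"
  assumes B: "B \<in> carrier_mat T k" and B': "B' \<in> carrier_mat T k'" and "k < T"
    and X: "X \<in> carrier_mat n k" and X': "X' \<in> carrier_mat n k'"
    and eq: "B * (transpose_mat X * X) * transpose_mat B + r \<cdot>\<^sub>m 1\<^sub>m T =
      B' * (transpose_mat X' * X') * transpose_mat B' + r' \<cdot>\<^sub>m 1\<^sub>m T"
  shows "r' \<le> r"
proof -
  obtain V where V: "V \<in> carrier_mat T 1" "V \<noteq> 0\<^sub>m T 1" "transpose_mat B * V = 0\<^sub>m k 1"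
    using wide_mat_kernel[of "transpose_mat B" k T] B \<open>k < T\<close> by auto
  \<comment> \<open>General in \<open>D\<close>, \<open>Z\<close> and \<open>s\<close>, so that the
    quadratic form at \<open>V\<close> can be evaluated on both sides of \<open>eq\<close>.\<close>
  have form: "transpose_mat V * (D * (transpose_mat Z * Z) * transpose_mat D + s \<cdot>\<^sub>m 1\<^sub>m T) * V =
      transpose_mat (Z * (transpose_mat D * V)) * (Z * (transpose_mat D * V)) +
      s \<cdot>\<^sub>m (transpose_mat V * V)"
    if D: "D \<in> carrier_mat T m" and Z: "Z \<in> carrier_mat n m" for D Z :: "real mat" and m s
  proof -
    have tD: "transpose_mat D \<in> carrier_mat m T" and tV: "transpose_mat V \<in> carrier_mat 1 T" using D V by auto
    note [simp] = carrier_matD[OF D] carrier_matD[OF Z] carrier_matD[OF V(1)]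
    have DV: "transpose_mat D * V \<in> carrier_mat m 1" using tD V by auto
    have "transpose_mat (Z * (transpose_mat D * V)) = transpose_mat V * D * transpose_mat Z"
      by (subst transpose_mult[OF Z DV], subst transpose_mult[OF tD V(1)]) simp
    then have "transpose_mat (Z * (transpose_mat D * V)) * (Z * (transpose_mat D * V)) =
      transpose_mat V * (D * (transpose_mat Z * Z) * transpose_mat D) * V"
      by (simp add: mult_assoc_dim)
    moreover have "transpose_mat V * (s \<cdot>\<^sub>m 1\<^sub>m T) * V = s \<cdot>\<^sub>m (transpose_mat V * V)"
      using V(1) tV right_mult_one_mat[OF tV]
      by (simp add: mult_smult_distrib[OF tV one_carrier_mat] mult_smult_assoc_mat[OF tV V(1)])
    moreover have "transpose_mat V * (W + s \<cdot>\<^sub>m 1\<^sub>m T) * V =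
        transpose_mat V * W * V + transpose_mat V * (s \<cdot>\<^sub>m 1\<^sub>m T) * V"
      if W: "W \<in> carrier_mat T T" for W
      using W tV V(1) mult_carrier_mat[OF tV W]
      by (simp add: mult_add_distrib_mat[OF tV W] add_mult_distrib_mat[of _ 1 T _ _ 1])
    moreover have "D * (transpose_mat Z * Z) * transpose_mat D \<in> carrier_mat T T"
      using D by auto
    ultimately show ?thesis by simp
  qed
  let ?g = "(transpose_mat V * V) $$ (0, 0)"
  have g: "0 < ?g"
  proof -
    have "?g \<noteq> 0"
    proof
      assume "?g = 0"
      then have "transpose_mat V * V = 0\<^sub>m 1 1" using V(1) by (intro eq_matI) auto
      then show False using gram_eq_0_imp[OF V(1)] V(2) by blast
    qed
    then show ?thesis using gram_index_nonneg[OF V(1), of 0] by simp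
  qed
  let ?Y = "X' * (transpose_mat B' * V)"
  have Y: "?Y \<in> carrier_mat n 1" using B' X' V(1) by auto
  have "X * (transpose_mat B * V) = 0\<^sub>m n 1" using V(3) X by simp
  then have "0\<^sub>m 1 1 + r \<cdot>\<^sub>m (transpose_mat V * V) = transpose_mat ?Y * ?Y + r' \<cdot>\<^sub>m (transpose_mat V * V)"
    using form[OF B X, of r] form[OF B' X', of r'] eq by simp
  from arg_cong[OF this, of "\<lambda>M. M $$ (0, 0)"]
  have "r * ?g = (transpose_mat ?Y * ?Y) $$ (0, 0) + r' * ?g"
    using V(1) Y by (simp add: index_add_mat)
  then have "r' * ?g \<le> r * ?g" using gram_index_nonneg[OF Y, of 0] by simp
  then show ?thesis using g by simp
qed

text \<open>The left inverse \<open>Y\<close> makes \<open>transpose_mat X * X\<close> positive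
  definite, so the left side of \<open>eq\<close> has the column space of \<open>B\<close>, and the
  right side places it inside that of \<open>B'\<close>. Hence the orthogonal projection
  \<open>B' * transpose_mat B'\<close> fixes \<open>B\<close>.\<close>

lemma basis_transfer:
  fixes B B' S' X Y :: "real mat"
  assumes B: "B \<in> carrier_mat T k" and B': "B' \<in> carrier_mat T k"
    and orth: "transpose_mat B * B = 1\<^sub>m k" "transpose_mat B' * B' = 1\<^sub>m k"
    and X: "X \<in> carrier_mat n k" and Y: "Y \<in> carrier_mat k n" and inv: "Y * X = 1\<^sub>m k"
    and S': "S' \<in> carrier_mat k k"
    and eq: "B * (transpose_mat X * X) * transpose_mat B = B' * S' * transpose_mat B'"
  shows "B = B' * (transpose_mat B' * B)"
proof -
  let ?N = "B' * (transpose_mat B' * B) - B"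
  have t: "transpose_mat B' \<in> carrier_mat k T" using B' by simp
  note [simp] = carrier_matD[OF B] carrier_matD[OF B'] carrier_matD[OF X] carrier_matD[OF S']
  have N: "?N \<in> carrier_mat T k" by (auto intro: carrier_matI)
  let ?G = "transpose_mat X * X"
  have G: "?G \<in> carrier_mat k k" by (auto intro: carrier_matI)
  \<comment> \<open>Multiplying \<open>eq\<close> by \<open>B\<close> on the right cancels
    \<open>transpose_mat B\<close> by orthonormality and puts the columns of \<open>B * ?G\<close>
    into the span of those of \<open>B'\<close>.\<close>
  have BG: "B * ?G = B' * (S' * (transpose_mat B' * B))"
  proof -
    have "B * ?G = B * ?G * transpose_mat B * B"
      using orth by (simp add: mult_assoc_dim right_mult_one_mat[OF X])
    also have "\<dots> = B' * (S' * (transpose_mat B' * B))"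
      unfolding eq
      by (simp add: mult_assoc_dim)
    finally show ?thesis .
  qed
  have "B' * (transpose_mat B' * B) * ?G = B' * (transpose_mat B' * (B * ?G))"
    by (simp add: mult_assoc_dim)
  also have "\<dots> = B' * ((transpose_mat B' * B') * (S' * (transpose_mat B' * B)))"
    unfolding BG by (simp add: mult_assoc_dim)
  also have "\<dots> = B * ?G"
    unfolding BG orth using B B' t S' by simp
  \<comment> \<open>The projection fixes \<open>B * ?G\<close>, so the defect \<open>?N\<close> of
    \<open>B\<close> annihilates \<open>?G\<close>.\<close>
  finally have NG: "?N * ?G = 0\<^sub>m T k"
    using B B' t G by (simp add: minus_mult_distrib_mat[of _ T k _ _ k])
  \<comment> \<open>The Gram matrix of \<open>?Z\<close> is
    \<open>?N * ?G * transpose_mat ?N\<close>, hence zero. So \<open>?Z\<close> vanishes, and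
    multiplying by \<open>Y\<close> removes \<open>X\<close> from it.\<close>
  let ?Z = "X * transpose_mat ?N"
  have tN: "transpose_mat ?N \<in> carrier_mat k T" using N by auto
  have Z: "?Z \<in> carrier_mat n T" by (auto intro: carrier_matI)
  have "transpose_mat ?Z = ?N * transpose_mat X"
    by (subst transpose_mult[OF X tN]) simp
  then have "transpose_mat ?Z * ?Z = ?N * ?G * transpose_mat ?N"
    by (simp add: mult_assoc_dim)
  also have "\<dots> = 0\<^sub>m T T" unfolding NG using tN by (rule left_mult_zero_mat)
  finally have "?Z = 0\<^sub>m n T" by (rule gram_eq_0_imp[OF Z])
  then have "Y * X * transpose_mat ?N = 0\<^sub>m k T"
    using Y by (simp add: mult_assoc_dim)
  then have "transpose_mat ?N = 0\<^sub>m k T"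
    unfolding inv left_mult_one_mat[OF tN] .
  then have N0: "?N = 0\<^sub>m T k" by (metis transpose_transpose zero_transpose_mat)
  show ?thesis
  proof (rule eq_matI)
    show "B $$ (a, b) = (B' * (transpose_mat B' * B)) $$ (a, b)"
      if "a < dim_row (B' * (transpose_mat B' * B))" "b < dim_col (B' * (transpose_mat B' * B))" for a b
      using arg_cong[OF N0, of "\<lambda>M. M $$ (a, b)"] that B B' by simp
  qed (use B B' in auto)
qed

text \<open>\<open>G\<close> and \<open>Z\<close> are the inverses of \<open>F\<close> and
  \<open>Y\<close>, so both sides are the inverse of the same matrix
  \<open>transpose_mat F * F\<close>. In the application they are precision matrices.\<close>

lemma precision_unique:
  fixes F G Y Z :: "real mat"
  assumes c: "F \<in> carrier_mat n n" "G \<in> carrier_mat n n" "Y \<in> carrier_mat n n" "Z \<in> carrier_mat n n"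
    and FG: "F * G = 1\<^sub>m n" and YZ: "Y * Z = 1\<^sub>m n"
    and eq: "transpose_mat F * F = transpose_mat Y * Y"
  shows "G * transpose_mat G = Z * transpose_mat Z"
proof -
  have t: "transpose_mat F \<in> carrier_mat n n" "transpose_mat G \<in> carrier_mat n n"
    "transpose_mat Y \<in> carrier_mat n n" "transpose_mat Z \<in> carrier_mat n n" using c by auto
  note [simp] = c[THEN carrier_matD(1)] c[THEN carrier_matD(2)]
  have GF: "G * F = 1\<^sub>m n" using mat_mult_left_right_inverse[OF c(1,2) FG] .
  have ZY: "Z * Y = 1\<^sub>m n" using mat_mult_left_right_inverse[OF c(3,4) YZ] .
  have tGF: "transpose_mat G * transpose_mat F = 1\<^sub>m n"
    using transpose_mult[OF c(1,2)] FG by simp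
  have tYZ: "transpose_mat Y * transpose_mat Z = 1\<^sub>m n"
    using transpose_mult[OF c(4,3)] ZY by simp
  have "transpose_mat Y * Y * (Z * transpose_mat Z) = transpose_mat Y * ((Y * Z) * transpose_mat Z)"
    by (simp add: mult_assoc_dim)
  also have "\<dots> = 1\<^sub>m n" unfolding YZ using t tYZ by simp
  finally have YYZZ: "transpose_mat Y * Y * (Z * transpose_mat Z) = 1\<^sub>m n" .
  have GGFF: "G * transpose_mat G * (transpose_mat F * F) = 1\<^sub>m n"
  proof -
    have "G * transpose_mat G * (transpose_mat F * F) = G * ((transpose_mat G * transpose_mat F) * F)"
      by (simp add: mult_assoc_dim)
    then show ?thesis unfolding tGF using c GF by simp
  qed
  have "G * transpose_mat G = G * transpose_mat G * (transpose_mat Y * Y * (Z * transpose_mat Z))"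
    unfolding YYZZ using c t by simp
  also have "\<dots> = G * transpose_mat G * (transpose_mat F * F) * (Z * transpose_mat Z)"
    unfolding eq by (simp add: mult_assoc_dim)
  also have "\<dots> = Z * transpose_mat Z" unfolding GGFF using c t by simp
  finally show ?thesis .
qed

section \<open>Coordinates and blocks of the coefficient vector\<close>

text \<open>\<open>coord L K j l k\<close> is the position in \<open>x\<close> of coefficient \<open>k\<close> of function \<open>l\<close> of node \<open>j\<close>.\<close>

definition coord :: "(nat \<Rightarrow> nat) \<Rightarrow> (nat \<Rightarrow> nat) \<Rightarrow> nat \<Rightarrow> nat \<Rightarrow> nat \<Rightarrow> nat" where
  "coord L K j l k = node_offset L K j + l * K j + k"

definition node_of :: "(nat \<Rightarrow> nat) \<Rightarrow> (nat \<Rightarrow> nat) \<Rightarrow> nat \<Rightarrow> nat" where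
  "node_of L K = block_at (\<lambda>i. L i * K i)"

definition fun_of :: "(nat \<Rightarrow> nat) \<Rightarrow> (nat \<Rightarrow> nat) \<Rightarrow> nat \<Rightarrow> nat" where
  "fun_of L K p = (p - node_offset L K (node_of L K p)) div K (node_of L K p)"

definition coeff_of :: "(nat \<Rightarrow> nat) \<Rightarrow> (nat \<Rightarrow> nat) \<Rightarrow> nat \<Rightarrow> nat" where
  "coeff_of L K p = (p - node_offset L K (node_of L K p)) mod K (node_of L K p)"

lemma coord_decode:
  assumes "l < L j" "k < K j"
  shows "node_of L K (coord L K j l k) = j" "fun_of L K (coord L K j l k) = l"
    "coeff_of L K (coord L K j l k) = k"
proof -
  have "l * K j + k < L j * K j" using assms by (rule mult_add_less)
  then show n: "node_of L K (coord L K j l k) = j"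
    using block_at_offset[of "l * K j + k" "\<lambda>i. L i * K i" j]
    by (simp add: coord_def node_of_def node_offset_def add.assoc)
  show "fun_of L K (coord L K j l k) = l" "coeff_of L K (coord L K j l k) = k"
    using assms unfolding fun_of_def coeff_of_def n by (auto simp: coord_def)
qed

lemma coord_less:
  assumes "j < P" "l < L j" "k < K j"
  shows "coord L K j l k < x_dim P L K"
  using offset_less_total[of j P "l * K j + k" "\<lambda>i. L i * K i"] assms mult_add_less[of l "L j" k "K j"]
  by (simp add: coord_def node_offset_def x_dim_def add.assoc)

text \<open>Induction on \<open>P\<close> finds the node range that contains \<open>p\<close>;
  dividing the remaining offset by \<open>K j\<close> yields the function and the
  coefficient.\<close>

lemma coord_cases:
  assumes "p < x_dim P L K"
  obtains j l k where "j < P" "l < L j" "k < K j" "p = coord L K j l k"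
proof -
  have "\<exists>j<P. \<exists>u<L j * K j. p = node_offset L K j + u"
    using assms
  proof (induction P)
    case 0
    then show ?case by (simp add: x_dim_def)
  next
    case (Suc P)
    show ?case
    proof (cases "p < x_dim P L K")
      case True
      then show ?thesis using Suc.IH by (meson less_SucI)
    next
      case False
      have "p = node_offset L K P + (p - x_dim P L K)" "p - x_dim P L K < L P * K P"
        using False Suc.prems by (auto simp: node_offset_def offset_def x_dim_def)
      then show ?thesis by blast
    qed
  qed
  then obtain j u where j: "j < P" and u: "u < L j * K j" "p = node_offset L K j + u" by blast
  have "0 < K j" using u(1) by (cases "K j") auto
  then show thesis
    using that[of j "u div K j" "u mod K j"] j u
    by (simp add: coord_def less_mult_imp_div_less)
qed

text \<open>The inclusion of the coordinates of function \<open>l\<close> of node \<open>j\<close>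
  into the full space. Products with it turn the extraction of blocks into matrix algebra.\<close>

definition embed_mat :: "nat \<Rightarrow> (nat \<Rightarrow> nat) \<Rightarrow> (nat \<Rightarrow> nat) \<Rightarrow> nat \<Rightarrow> nat \<Rightarrow> real mat" where
  "embed_mat P L K j l =
     mat (x_dim P L K) (K j) (\<lambda>(p, b). if p = coord L K j l b then 1 else 0)"

lemma embed_mat_carrier [simp]: "embed_mat P L K j l \<in> carrier_mat (x_dim P L K) (K j)"
  by (simp add: embed_mat_def)

lemma mult_embed_mat_index:
  assumes "A \<in> carrier_mat m (x_dim P L K)" "j < P" "l < L j" "i < m" "b < K j"
  shows "(A * embed_mat P L K j l) $$ (i, b) = A $$ (i, coord L K j l b)"
proof -
  have "(A * embed_mat P L K j l) $$ (i, b) =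
      (\<Sum>q<x_dim P L K. A $$ (i, q) * (if q = coord L K j l b then 1 else 0))"
    using assms by (subst index_mult_mat_sum[OF assms(1) embed_mat_carrier]) (auto simp: embed_mat_def)
  then show ?thesis
    using coord_less[of j P l L b K] assms by (simp add: if_distrib cong: if_cong)
qed

text \<open>An embedding on the right selects columns; the selection of rows is the same fact for
  the transpose.\<close>

lemma fun_block_eq_embed:
  assumes A: "A \<in> carrier_mat (x_dim P L K) (x_dim P L K)" and "j < P" "l < L j" "j' < P" "l' < L j'"
  shows "fun_block L K A j l j' l' =
    transpose_mat (embed_mat P L K j l) * A * embed_mat P L K j' l'"
proof (rule eq_matI)
  let ?E = "embed_mat P L K j l" and ?E' = "embed_mat P L K j' l'"
  fix a b assume "a < dim_row (transpose_mat ?E * A * ?E')" "b < dim_col (transpose_mat ?E * A * ?E')"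
  then have a: "a < K j" and b: "b < K j'" by (auto simp: embed_mat_def)
  have "transpose_mat ?E * A = transpose_mat (transpose_mat A * ?E)"
    using transpose_mult[of "transpose_mat A" _ _ ?E] A by (metis embed_mat_carrier transpose_carrier_mat transpose_transpose)
  moreover have "(transpose_mat ?E * A * ?E') $$ (a, b) = (transpose_mat ?E * A) $$ (a, coord L K j' l' b)"
    using assms a b by (intro mult_embed_mat_index[of _ "K j"]) (auto intro!: mult_carrier_mat[where n = "x_dim P L K"])
  moreover have "(transpose_mat A * ?E) $$ (coord L K j' l' b, a) =
      transpose_mat A $$ (coord L K j' l' b, coord L K j l a)"
    using assms a b coord_less[of j' P l' L b K] by (intro mult_embed_mat_index[of _ "x_dim P L K"]) auto
  ultimately show "fun_block L K A j l j' l' $$ (a, b) = (transpose_mat ?E * A * ?E') $$ (a, b)"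
    using assms a b coord_less[of j' P l' L b K] coord_less[of j P l L a K]
    by (simp add: fun_block_def coord_def embed_mat_def)
qed (auto simp: fun_block_def embed_mat_def)

lemma embed_mat_orth:
  assumes "j < P" "l < L j"
  shows "transpose_mat (embed_mat P L K j l) * embed_mat P L K j l = 1\<^sub>m (K j)"
proof -
  have "transpose_mat (embed_mat P L K j l) * embed_mat P L K j l =
    fun_block L K (1\<^sub>m (x_dim P L K)) j l j l"
    using assms by (subst fun_block_eq_embed) (auto simp: right_mult_one_mat[of _ "K j"])
  also have "\<dots> = 1\<^sub>m (K j)"
    using assms coord_less[of j P l L _ K] by (intro eq_matI) (auto simp: fun_block_def coord_def)
  finally show ?thesis .
qed

lemma mat_eq_by_fun_blocks:
  assumes A: "A \<in> carrier_mat (x_dim P L K) (x_dim P L K)" and B: "B \<in> carrier_mat (x_dim P L K) (x_dim P L K)"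
    and eq: "\<And>j l j' l'. j < P \<Longrightarrow> l < L j \<Longrightarrow> j' < P \<Longrightarrow> l' < L j' \<Longrightarrow>
      fun_block L K A j l j' l' = fun_block L K B j l j' l'"
  shows "A = B"
proof (rule eq_matI)
  fix p q assume "p < dim_row B" "q < dim_col B"
  then obtain j l k j' l' k' where p: "j < P" "l < L j" "k < K j" "p = coord L K j l k"
    and q: "j' < P" "l' < L j'" "k' < K j'" "q = coord L K j' l' k'"
    using B coord_cases[of p P L K] coord_cases[of q P L K] by (metis carrier_matD)
  then show "A $$ (p, q) = B $$ (p, q)"
    using arg_cong[OF eq[OF p(1,2) q(1,2)], of "\<lambda>M. M $$ (k, k')"]
    by (simp add: fun_block_def coord_def)
qed (use A B in auto)

section \<open>Block diagonal rotations\<close>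

text \<open>The block diagonal matrix with block \<open>Q j\<close> at every function of node \<open>j\<close>, given column by column.\<close>

definition block_rotation ::
  "nat \<Rightarrow> (nat \<Rightarrow> nat) \<Rightarrow> (nat \<Rightarrow> nat) \<Rightarrow> (nat \<Rightarrow> real mat) \<Rightarrow> real mat" where
  "block_rotation P L K Q = mat (x_dim P L K) (x_dim P L K) (\<lambda>(p, q).
     (embed_mat P L K (node_of L K q) (fun_of L K q) * Q (node_of L K q)) $$ (p, coeff_of L K q))"

lemma block_rotation_carrier [simp]: "block_rotation P L K Q \<in> carrier_mat (x_dim P L K) (x_dim P L K)"
  by (simp add: block_rotation_def)

text \<open>This intertwining relation expresses the block diagonal form without entries, so that
  later products with the rotation are handled by associativity.\<close>

lemma block_rotation_embed:
  assumes "Q j \<in> carrier_mat (K j) (K j)" "j < P" "l < L j"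
  shows "block_rotation P L K Q * embed_mat P L K j l = embed_mat P L K j l * Q j"
proof (rule eq_matI)
  fix p b assume "p < dim_row (embed_mat P L K j l * Q j)" "b < dim_col (embed_mat P L K j l * Q j)"
  then have p: "p < x_dim P L K" and b: "b < K j" using assms(1) by (auto simp: embed_mat_def)
  then show "(block_rotation P L K Q * embed_mat P L K j l) $$ (p, b) = (embed_mat P L K j l * Q j) $$ (p, b)"
    using assms mult_embed_mat_index[OF block_rotation_carrier assms(2,3) p b, of Q]
    by (simp add: block_rotation_def coord_less coord_decode[of l L j b K])
qed (use assms in \<open>auto simp: embed_mat_def block_rotation_def\<close>)

text \<open>Written with embeddings, the rotations on both sides move past them by
  \<open>block_rotation_embed\<close> and its transpose, and what remains in the middle is the block
  of \<open>S\<close>.\<close>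

lemma fun_block_rotation:
  assumes Q: "\<And>j. j < P \<Longrightarrow> Q j \<in> carrier_mat (K j) (K j)"
    and S: "S \<in> carrier_mat (x_dim P L K) (x_dim P L K)" and "j < P" "l < L j" "j' < P" "l' < L j'"
  shows "fun_block L K (transpose_mat (block_rotation P L K Q) * S * block_rotation P L K Q) j l j' l' =
    transpose_mat (Q j) * fun_block L K S j l j' l' * Q j'"
proof -
  let ?n = "x_dim P L K" and ?E = "embed_mat P L K j l" and ?E' = "embed_mat P L K j' l'"
  let ?R = "block_rotation P L K Q"
  note Qj = Q[OF \<open>j < P\<close>] and Qj' = Q[OF \<open>j' < P\<close>]
  have E: "?E \<in> carrier_mat ?n (K j)" "?E' \<in> carrier_mat ?n (K j')" "transpose_mat ?E \<in> carrier_mat (K j) ?n"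
    and R: "?R \<in> carrier_mat ?n ?n" "transpose_mat ?R \<in> carrier_mat ?n ?n"
    and tQ: "transpose_mat (Q j) \<in> carrier_mat (K j) (K j)"
    using Qj by simp_all
  have tE: "transpose_mat ?E * transpose_mat ?R = transpose_mat (Q j) * transpose_mat ?E"
    using block_rotation_embed[of Q j K P l L] transpose_mult[OF R(1) E(1)] transpose_mult[OF E(1) Qj] Qj assms
    by simp
  note [simp] = carrier_matD[OF S] carrier_matD[OF Qj] carrier_matD[OF Qj'] carrier_matD[OF E(1)]
    carrier_matD[OF E(2)] carrier_matD[OF R(1)]
  have c: "S * ?R \<in> carrier_mat ?n ?n" "transpose_mat ?R * (S * ?R) \<in> carrier_mat ?n ?n"
    "?R * ?E' \<in> carrier_mat ?n (K j')" "transpose_mat ?E * S \<in> carrier_mat (K j) ?n"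
    "?E' * Q j' \<in> carrier_mat ?n (K j')" "S * ?E' \<in> carrier_mat ?n (K j')"
    by (auto intro: carrier_matI)
  have "fun_block L K (transpose_mat ?R * S * ?R) j l j' l' =
      (transpose_mat ?E * transpose_mat ?R) * (S * (?R * ?E'))"
    using assms c by (subst fun_block_eq_embed[where P = P]) (simp_all add: mult_assoc_dim)
  also have "\<dots> = (transpose_mat (Q j) * transpose_mat ?E) * (S * (?E' * Q j'))"
    unfolding tE using block_rotation_embed[of Q j' K P l' L] Qj' assms by simp
  also have "\<dots> = transpose_mat (Q j) * fun_block L K S j l j' l' * Q j'"
    using assms c by (subst fun_block_eq_embed[where P = P]) (simp_all add: mult_assoc_dim)
  finally show ?thesis .
qed

lemma mat_add_right_cancel:
  fixes A B C :: "'a::cancel_semigroup_add mat"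
  assumes "A \<in> carrier_mat m n" "B \<in> carrier_mat m n" "C \<in> carrier_mat m n" "A + C = B + C"
  shows "A = B"
proof (rule eq_matI)
  show "A $$ (i, j) = B $$ (i, j)" if "i < dim_row B" "j < dim_col B" for i j
    using arg_cong[OF assms(4), of "\<lambda>M. M $$ (i, j)"] assms(1-3) that by simp
qed (use assms in auto)

section \<open>Zero patterns of acyclic coefficient matrices and invertibility\<close>

text \<open>Passes from zero blocks between two nodes to zero entries, both for a coefficient matrix
  and for its rotated copy.\<close>

lemma entry_eq_0_by_fun_blocks:
  assumes "p < x_dim P L K" "q < x_dim P L K"
    and zero: "\<And>l l'. l < L (node_of L K p) \<Longrightarrow> l' < L (node_of L K q) \<Longrightarrow>
      fun_block L K A (node_of L K p) l (node_of L K q) l' = 0\<^sub>m (K (node_of L K p)) (K (node_of L K q))"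
  shows "A $$ (p, q) = 0"
proof -
  obtain j l k where p: "j < P" "l < L j" "k < K j" "p = coord L K j l k"
    using coord_cases assms(1) .
  obtain j' l' k' where q: "j' < P" "l' < L j'" "k' < K j'" "q = coord L K j' l' k'"
    using coord_cases assms(2) .
  have "fun_block L K A j l j' l' $$ (k, k') = 0"
    using zero[of l l'] p q by (simp add: coord_decode)
  then show ?thesis using p q by (simp add: fun_block_def coord_def)
qed

lemma node_of_less: "p < x_dim P L K \<Longrightarrow> node_of L K p < P"
  by (erule coord_cases) (simp add: coord_decode)

lemma fun_block_eq_0:
  assumes "(j, j') \<notin> node_graph P L K C" "j < P" "j' < P" "l < L j" "l' < L j'"
  shows "fun_block L K C j l j' l' = 0\<^sub>m (K j) (K j')"
proof (rule eq_matI)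
  have N: "node_block L K C j j' = 0\<^sub>m (L j * K j) (L j' * K j')"
    using assms by (simp add: node_graph_def)
  fix a b assume "a < dim_row (0\<^sub>m (K j) (K j') :: real mat)" "b < dim_col (0\<^sub>m (K j) (K j') :: real mat)"
  then have ab: "a < K j" "b < K j'" by simp_all
  have "node_block L K C j j' $$ (l * K j + a, l' * K j' + b) = 0"
    unfolding N using mult_add_less[OF assms(4) ab(1)] mult_add_less[OF assms(5) ab(2)] by simp
  then show "fun_block L K C j l j' l' $$ (a, b) = 0\<^sub>m (K j) (K j') $$ (a, b)"
    using mult_add_less[OF assms(4) ab(1)] mult_add_less[OF assms(5) ab(2)] ab
    by (simp add: node_block_def fun_block_def add.assoc)
qed (auto simp: fun_block_def)

text \<open>The sink is sought among coordinates, compared through their nodes. A \<open>q\<close>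
  in the node of \<open>p\<close>, in particular \<open>q = p\<close>, is covered because an acyclic
  graph has no loops.\<close>

lemma node_graph_sink:
  assumes "acyclic (node_graph P L K C)" "U \<noteq> {}"
  obtains p where "p \<in> U" "\<And>q. q \<in> U \<Longrightarrow> (node_of L K p, node_of L K q) \<notin> node_graph P L K C"
proof -
  have "finite (node_graph P L K C)"
    by (rule finite_subset[of _ "{..<P} \<times> {..<P}"]) (auto simp: node_graph_def)
  then show thesis using finite_acyclic_sink assms that by metis
qed

lemma coef_entry_eq_0:
  assumes "(node_of L K p, node_of L K q) \<notin> node_graph P L K C" "p < x_dim P L K" "q < x_dim P L K"
  shows "C $$ (p, q) = 0"
  using assms by (intro entry_eq_0_by_fun_blocks fun_block_eq_0) (auto intro: node_of_less)

text \<open>A kernel vector \<open>v\<close> satisfies \<open>v = C v\<close>. At a sink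
  \<open>p\<close> of its support, entry \<open>p\<close> of \<open>C v\<close> vanishes although
  that of \<open>v\<close> does not.\<close>

lemma det_one_minus_coef:
  assumes C: "C \<in> carrier_mat (x_dim P L K) (x_dim P L K)" and acyc: "acyclic (node_graph P L K C)"
  shows "det (1\<^sub>m (x_dim P L K) - C) \<noteq> 0"
proof
  let ?n = "x_dim P L K"
  have A: "1\<^sub>m ?n - C \<in> carrier_mat ?n ?n" using C by (rule minus_carrier_mat)
  assume "det (1\<^sub>m ?n - C) = 0"
  then obtain v where v: "v \<in> carrier_vec ?n" "v \<noteq> 0\<^sub>v ?n" "(1\<^sub>m ?n - C) *\<^sub>v v = 0\<^sub>v ?n"
    using det_0_iff_vec_prod_zero_field[OF A] by blast
  define U where "U = {p. p < ?n \<and> v $ p \<noteq> 0}"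
  have "U \<noteq> {}" using v(1,2) by (auto simp: U_def)
  then obtain p where p: "p \<in> U" "\<And>q. q \<in> U \<Longrightarrow> (node_of L K p, node_of L K q) \<notin> node_graph P L K C"
    using node_graph_sink[OF acyc] by metis
  have pn: "p < ?n" using p(1) by (simp add: U_def)
  have "0 = ((1\<^sub>m ?n - C) *\<^sub>v v) $ p" unfolding v(3) using pn by simp
  also have "\<dots> = (\<Sum>q<?n. (1\<^sub>m ?n - C) $$ (p, q) * v $ q)"
    using C v(1) pn by (simp add: scalar_prod_def atLeast0LessThan)
  \<comment> \<open>Each \<open>q\<close> either lies outside the support of \<open>v\<close> or is
    no successor of \<open>p\<close>, so only the 1 on the diagonal survives.\<close>
  also have "\<dots> = (\<Sum>q<?n. if q = p then v $ p else 0)"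
  proof (rule sum.cong)
    fix q assume q: "q \<in> {..<?n}"
    have "C $$ (p, q) = 0 \<or> v $ q = 0"
      using q p(2)[of q] pn coef_entry_eq_0[of L K p q P C] by (auto simp: U_def)
    moreover have "C $$ (p, p) = 0"
      using p pn coef_entry_eq_0[of L K p p P C] by auto
    ultimately show "(1\<^sub>m ?n - C) $$ (p, q) * v $ q = (if q = p then v $ p else 0)"
      using q pn C by auto
  qed simp
  also have "\<dots> = v $ p" using pn by simp
  finally show False using p(1) by (simp add: U_def)
qed

text \<open>\<open>F\<close> is \<open>sqrt (innov_var \<Theta>)\<close> times the inverse of the
  identity minus \<open>coef \<Theta>\<close>. Sharing the variance between both factors makes the
  covariance an exact Gram matrix whose factor has an explicit inverse.\<close>

lemma cov_x_factor:
  assumes "admissible P T L K \<Theta>"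
  obtains F where "F \<in> carrier_mat (x_dim P L K) (x_dim P L K)"
    "cov_x P L K \<Theta> = transpose_mat F * F"
    "F * ((1 / sqrt (innov_var \<Theta>)) \<cdot>\<^sub>m (1\<^sub>m (x_dim P L K) - coef \<Theta>)) = 1\<^sub>m (x_dim P L K)"
proof -
  let ?n = "x_dim P L K" and ?w = "innov_var \<Theta>"
  let ?A = "1\<^sub>m ?n - coef \<Theta>"
  have C: "coef \<Theta> \<in> carrier_mat ?n ?n" and acyc: "acyclic (node_graph P L K (coef \<Theta>))" and w: "?w > 0"
    using assms by (auto simp: admissible_def)
  have A: "?A \<in> carrier_mat ?n ?n" using C by (rule minus_carrier_mat)
  \<comment> \<open>The nonzero determinant excludes \<open>None\<close>. The parameter
    \<open>b\<close> is an arbitrary extra component of the matrix ring, fixed so that both facts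
    speak of the same ring.\<close>
  obtain W where "mat_inverse ?A = Some W"
    using mat_inverse(1)[OF A, where b = "()"]
      det_non_zero_imp_unit[OF A det_one_minus_coef[OF C acyc], where b = "()"]
    by (cases "mat_inverse ?A") auto
  then have W: "W \<in> carrier_mat ?n ?n" "W * ?A = 1\<^sub>m ?n" "the (mat_inverse ?A) = W"
    using mat_inverse(2)[OF A] by auto
  show thesis
  proof
    show "sqrt ?w \<cdot>\<^sub>m W \<in> carrier_mat ?n ?n" using W by simp
    show "cov_x P L K \<Theta> = transpose_mat (sqrt ?w \<cdot>\<^sub>m W) * (sqrt ?w \<cdot>\<^sub>m W)"
      unfolding cov_x_def W(3) Let_def
      using W(1) w by (intro eq_matI) (auto simp: scalar_prod_def sum_distrib_left intro!: sum.cong)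
    show "sqrt ?w \<cdot>\<^sub>m W * ((1 / sqrt ?w) \<cdot>\<^sub>m ?A) = 1\<^sub>m ?n"
      using w A W(1,2) by (intro eq_matI)
        (simp_all add: mult_smult_distrib[of _ ?n ?n] mult_smult_assoc_mat[of _ ?n ?n])
  qed
qed

section \<open>From covariances of the observations to rotated covariances of the
  coefficients\<close>

lemma cov_Y_block_carrier:
  assumes "admissible P T L K \<Theta>" "j < P" "j' < P"
  shows "cov_Y_block P T L K \<Theta> j l j' l' \<in> carrier_mat T T"
proof -
  have "basis \<Theta> j \<in> carrier_mat T (K j)" "basis \<Theta> j' \<in> carrier_mat T (K j')"
    using assms by (auto simp: admissible_def)
  then show ?thesis by (auto simp: cov_Y_block_def Let_def)
qed

lemma cov_Y_block_eq:
  assumes "cov_Y P T L K \<Theta> = cov_Y P T L K \<Theta>'" "admissible P T L K \<Theta>" "admissible P T L K \<Theta>'"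
    and "j < P" "j' < P" "l < L j" "l' < L j'"
  shows "cov_Y_block P T L K \<Theta> j l j' l' = cov_Y_block P T L K \<Theta>' j l j' l'"
proof -
  have "cov_Y_block P T L K \<Theta> j l j' l' $$ (t, t') = cov_Y_block P T L K \<Theta>' j l j' l' $$ (t, t')"
    if "t < T" "t' < T" for t t'
    using assms that cov_Y_index[of j P l L t T j' l' t' K \<Theta>] cov_Y_index[of j P l L t T j' l' t' K \<Theta>']
    by simp
  then show ?thesis
    using cov_Y_block_carrier[of P T L K \<Theta> j j' l l'] cov_Y_block_carrier[of P T L K \<Theta>' j j' l l'] assms
    by (intro eq_matI) auto
qed

text \<open>Multiplying \<open>eq\<close> by \<open>transpose_mat B\<close> on the left and by
  \<open>B'\<close> on the right isolates \<open>S\<close>, since both bases have orthonormal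
  columns. The products \<open>transpose_mat D * B\<close> and \<open>transpose_mat D' * B'\<close>
  become the rotations.\<close>

lemma coeff_cov_transfer:
  fixes B D :: "real mat"
  assumes B: "B \<in> carrier_mat T k" and B': "B' \<in> carrier_mat T k'"
    and D: "D \<in> carrier_mat T k" and D': "D' \<in> carrier_mat T k'"
    and S: "S \<in> carrier_mat k k'" and R: "R \<in> carrier_mat k k'"
    and orth: "transpose_mat B * B = 1\<^sub>m k" "transpose_mat B' * B' = 1\<^sub>m k'"
    and eq: "B * S * transpose_mat B' = D * R * transpose_mat D'"
  shows "S = transpose_mat (transpose_mat D * B) * R * (transpose_mat D' * B')"
proof -
  note [simp] = carrier_matD[OF B] carrier_matD[OF B'] carrier_matD[OF D] carrier_matD[OF D']
    carrier_matD[OF S] carrier_matD[OF R]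
  have t: "transpose_mat D \<in> carrier_mat k T" using D by simp
  have "S = (transpose_mat B * B) * S * (transpose_mat B' * B')"
    unfolding orth using S by simp
  also have "\<dots> = transpose_mat B * (B * S * transpose_mat B') * B'"
    by (simp add: mult_assoc_dim)
  also have "\<dots> = (transpose_mat B * D) * R * (transpose_mat D' * B')"
    unfolding eq by (simp add: mult_assoc_dim)
  finally show ?thesis by (simp add: transpose_mult[OF t B])
qed

lemma fun_block_one:
  assumes "j < P" "l < L j" "j' < P" "l' < L j'"
  shows "fun_block L K (1\<^sub>m (x_dim P L K)) j l j' l' =
    (if (j, l) = (j', l') then 1\<^sub>m (K j) else 0\<^sub>m (K j) (K j') :: real mat)"
proof (rule eq_matI)
  fix a b
  assume "a < dim_row (if (j, l) = (j', l') then 1\<^sub>m (K j) else 0\<^sub>m (K j) (K j') :: real mat)"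
    "b < dim_col (if (j, l) = (j', l') then 1\<^sub>m (K j) else 0\<^sub>m (K j) (K j') :: real mat)"
  then have ab: "a < K j" "b < K j'" by (auto split: if_splits)
  have "coord L K j l a = coord L K j' l' b \<longleftrightarrow> (j, l, a) = (j', l', b)"
    using coord_decode[of l L j a K] coord_decode[of l' L j' b K] assms ab by (metis Pair_inject)
  then show "fun_block L K (1\<^sub>m (x_dim P L K)) j l j' l' $$ (a, b) =
      (if (j, l) = (j', l') then 1\<^sub>m (K j) else 0\<^sub>m (K j) (K j') :: real mat) $$ (a, b)"
    using assms ab coord_less[of j P l L a K] coord_less[of j' P l' L b K]
    by (auto simp: fun_block_def coord_def)
qed (auto simp: fun_block_def)

text \<open>The rotated identity matrix has diagonal blocks
  \<open>transpose_mat (Q j) * Q j\<close>, and its other blocks stay zero.\<close>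

lemma block_rotation_orth:
  assumes "\<And>j. j < P \<Longrightarrow> Q j \<in> carrier_mat (K j) (K j)"
    and "\<And>j. j < P \<Longrightarrow> transpose_mat (Q j) * Q j = 1\<^sub>m (K j)"
  shows "transpose_mat (block_rotation P L K Q) * block_rotation P L K Q = 1\<^sub>m (x_dim P L K)"
proof (rule mat_eq_by_fun_blocks)
  let ?n = "x_dim P L K"
  show "transpose_mat (block_rotation P L K Q) * block_rotation P L K Q \<in> carrier_mat ?n ?n"
    by (rule mult_carrier_mat[where n = ?n]) simp_all
  fix j l j' l' assume j: "j < P" "l < L j" "j' < P" "l' < L j'"
  have "transpose_mat (block_rotation P L K Q) * block_rotation P L K Q =
      transpose_mat (block_rotation P L K Q) * 1\<^sub>m ?n * block_rotation P L K Q"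
    by (simp add: right_mult_one_mat[of _ ?n])
  then show "fun_block L K (transpose_mat (block_rotation P L K Q) * block_rotation P L K Q) j l j' l' =
      fun_block L K (1\<^sub>m ?n) j l j' l'"
    using assms(1)[OF j(1)] assms(1)[OF j(3)] assms(2)[OF j(1)] j fun_block_rotation[OF assms(1) one_carrier_mat j]
    by (auto simp: fun_block_one[where P = P] right_mult_one_mat[of _ "K j"]
        right_mult_zero_mat[of _ "K j"] left_mult_zero_mat[of _ "K j'"])
qed simp

section \<open>Uniqueness of the innovation variance and of the coefficients\<close>

text \<open>Inverting both sides of \<open>cov\<close> gives an equality of precision matrices whose
  factors \<open>?A\<close> and \<open>?B\<close> have unit diagonal up to the scaling. Sinks then
  determine the variance, and \<open>gram_unit_diagonal_unique\<close> the coefficients.\<close>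

lemma coef_unique_up_to_rotation:
  fixes C C' F F' :: "real mat" and L K :: "nat \<Rightarrow> nat" and P :: nat and Q :: "nat \<Rightarrow> real mat"
  defines "n \<equiv> x_dim P L K"
  defines "R \<equiv> block_rotation P L K Q"
  assumes "P > 0" "L 0 > 0" "K 0 > 0"
    and Q: "\<And>j. j < P \<Longrightarrow> Q j \<in> carrier_mat (K j) (K j)"
      "\<And>j. j < P \<Longrightarrow> transpose_mat (Q j) * Q j = 1\<^sub>m (K j)"
    and C: "C \<in> carrier_mat n n" and C': "C' \<in> carrier_mat n n"
    and acyc: "acyclic (node_graph P L K C)" "acyclic (node_graph P L K C')"
    and w: "w > 0" "w' > 0"
    and F: "F \<in> carrier_mat n n" "F * ((1 / sqrt w) \<cdot>\<^sub>m (1\<^sub>m n - C)) = 1\<^sub>m n"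
    and F': "F' \<in> carrier_mat n n" "F' * ((1 / sqrt w') \<cdot>\<^sub>m (1\<^sub>m n - C')) = 1\<^sub>m n"
    and cov: "transpose_mat F * F = transpose_mat R * (transpose_mat F' * F') * R"
  shows "w = w'" and "C = transpose_mat R * C' * R"
proof -
  let ?A = "1\<^sub>m n - C" and ?D = "transpose_mat R * C' * R"
  let ?B = "1\<^sub>m n - ?D"
  have R: "R \<in> carrier_mat n n" by (simp add: R_def n_def)
  note [simp] = carrier_matD[OF C] carrier_matD[OF C'] carrier_matD[OF R] carrier_matD[OF F(1)] carrier_matD[OF F'(1)]
  have tR: "transpose_mat R \<in> carrier_mat n n" using R by simp
  have D: "?D \<in> carrier_mat n n" by (auto intro: carrier_matI)
  have RR: "transpose_mat R * R = 1\<^sub>m n"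
    unfolding R_def n_def by (rule block_rotation_orth) (use Q in auto)
  have RR': "R * transpose_mat R = 1\<^sub>m n"
    using mat_mult_left_right_inverse[OF tR R RR] .
  have cancel: "R * (transpose_mat R * X) = X" if "X \<in> carrier_mat n n" for X
    using that RR' mult_assoc_dim[of R "transpose_mat R" X] by simp
  let ?G = "(1 / sqrt w) \<cdot>\<^sub>m ?A" and ?G' = "(1 / sqrt w') \<cdot>\<^sub>m (1\<^sub>m n - C')"
  \<comment> \<open>Conjugating \<open>F'\<close> and its inverse by the orthogonal \<open>R\<close>
    keeps them inverse to each other, and the Gram matrix of \<open>?Y\<close> is the right side of
    \<open>cov\<close>.\<close>
  let ?Y = "transpose_mat R * F' * R" and ?Z = "transpose_mat R * ?G' * R"
  have YY: "transpose_mat ?Y * ?Y = transpose_mat R * (transpose_mat F' * F') * R"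
  proof -
    have RF: "transpose_mat R * F' \<in> carrier_mat n n" "F' * R \<in> carrier_mat n n"
      by (auto intro: carrier_matI)
    have "transpose_mat ?Y = transpose_mat R * (transpose_mat F' * R)"
      by (simp add: transpose_mult[OF RF(1) R] transpose_mult[OF tR F'(1)])
    then have "transpose_mat ?Y * ?Y = transpose_mat R * (transpose_mat F' * (R * (transpose_mat R * (F' * R))))"
      by (simp add: mult_assoc_dim)
    then show ?thesis unfolding cancel[OF RF(2)] by (simp add: mult_assoc_dim)
  qed
  have YZ: "?Y * ?Z = 1\<^sub>m n"
  proof -
    have GR: "?G' * R \<in> carrier_mat n n" by (auto intro: carrier_matI)
    have "?Y * ?Z = transpose_mat R * (F' * (R * (transpose_mat R * (?G' * R))))"
      by (simp add: mult_assoc_dim)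
    also have "\<dots> = transpose_mat R * ((F' * ?G') * R)"
      unfolding cancel[OF GR] by (simp add: mult_assoc_dim)
    also have "\<dots> = 1\<^sub>m n" unfolding F'(2) using R RR by simp
    finally show ?thesis .
  qed
  have Z: "?Z = (1 / sqrt w') \<cdot>\<^sub>m ?B"
  proof -
    have "transpose_mat R * (1\<^sub>m n - C') * R = ?B"
      using C' R tR RR mult_carrier_mat[OF tR C']
      by (simp add: mult_minus_distrib_mat[OF tR _ C'] minus_mult_distrib_mat[OF _ _ R])
    moreover have "?Z = (1 / sqrt w') \<cdot>\<^sub>m (transpose_mat R * (1\<^sub>m n - C') * R)"
      using mult_smult_distrib[OF tR minus_carrier_mat[OF C']]
        mult_smult_assoc_mat[OF mult_carrier_mat[OF tR minus_carrier_mat[OF C']] R] by simp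
    ultimately show ?thesis by simp
  qed
  have "?G * transpose_mat ?G = ?Z * transpose_mat ?Z"
    by (rule precision_unique[OF F(1) _ _ _ F(2) YZ]) (auto simp: cov YY intro: carrier_matI)
  then have prec: "?G * transpose_mat ?G = ((1 / sqrt w') \<cdot>\<^sub>m ?B) * transpose_mat ((1 / sqrt w') \<cdot>\<^sub>m ?B)"
    unfolding Z .
  have gram_entry: "((1 / sqrt c) \<cdot>\<^sub>m M * transpose_mat ((1 / sqrt c) \<cdot>\<^sub>m M)) $$ (p, q) =
      (\<Sum>k<n. M $$ (p, k) * M $$ (q, k)) / c"
    if "M \<in> carrier_mat n n" "c > 0" "p < n" "q < n" for M :: "real mat" and c p q
    using that by (subst index_mult_mat_sum[of _ n n _ n]) (auto simp: sum_divide_distrib intro!: sum.cong)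
  have sums: "(\<Sum>k<n. ?A $$ (p, k) * ?A $$ (q, k)) / w = (\<Sum>k<n. ?B $$ (p, k) * ?B $$ (q, k)) / w'"
    if "p < n" "q < n" for p q
    using gram_entry[of ?A w p q] gram_entry[of ?B w' p q] prec that w C D by (simp add: minus_carrier_mat)
  have C0: "C $$ (p, q) = 0" if "(node_of L K p, node_of L K q) \<notin> node_graph P L K C" "p < n" "q < n" for p q
    using coef_entry_eq_0 that by (simp add: n_def)
  \<comment> \<open>The rotation acts inside each node, so a zero block of \<open>C'\<close> stays
    zero in \<open>?D\<close>.\<close>
  have D0: "?D $$ (p, q) = 0" if pq: "(node_of L K p, node_of L K q) \<notin> node_graph P L K C'" "p < n" "q < n" for p q
  proof (rule entry_eq_0_by_fun_blocks)
    let ?j = "node_of L K p" and ?j' = "node_of L K q"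
    have j: "?j < P" "?j' < P" using pq by (auto simp: n_def intro: node_of_less)
    fix l l' assume l: "l < L ?j" "l' < L ?j'"
    have "fun_block L K ?D ?j l ?j' l' = transpose_mat (Q ?j) * fun_block L K C' ?j l ?j' l' * Q ?j'"
      unfolding R_def by (rule fun_block_rotation[OF Q(1) C'[unfolded n_def] j(1) l(1) j(2) l(2)])
    then show "fun_block L K ?D ?j l ?j' l' = 0\<^sub>m (K ?j) (K ?j')"
      using Q(1)[OF j(1)] Q(1)[OF j(2)] fun_block_eq_0[OF pq(1) j l]
      by (simp add: right_mult_zero_mat[of _ "K ?j"] left_mult_zero_mat[of _ "K ?j'"])
  qed (use pq in \<open>auto simp: n_def\<close>)
  have diag: "?A $$ (p, p) = 1" "?B $$ (p, p) = 1" if "p < n" for p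
    using C0[of p p] D0[of p p] that acyc D by (auto simp: acyclic_def)
  \<comment> \<open>The positive dimensions of node 0 provide a coordinate, so that sinks
    exist.\<close>
  have npos: "{..<n} \<noteq> {}"
    using coord_less[of 0 P 0 L 0 K] assms by (auto simp: n_def)
  have one_le: "1 \<le> (\<Sum>k<n. M $$ (p, k) * M $$ (p, k))"
    if "M $$ (p, p) = 1" "p < n" for M :: "real mat" and p
    using that member_le_sum[of p "{..<n}" "\<lambda>k. M $$ (p, k) * M $$ (p, k)"] by simp
  have sink_eq: "(\<Sum>k<n. M $$ (p, k) * M $$ (p, k)) = 1"
    if "p < n" "M $$ (p, p) = 1" "\<And>q. q < n \<Longrightarrow> q \<noteq> p \<Longrightarrow> M $$ (p, q) = 0" for M :: "real mat" and p
  proof -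
    have "(\<Sum>k<n. M $$ (p, k) * M $$ (p, k)) = (\<Sum>k<n. if k = p then 1 else 0)"
      using that by (intro sum.cong) auto
    then show ?thesis using that(1) by simp
  qed
  \<comment> \<open>At a sink of the graph of \<open>C\<close> the row of \<open>?A\<close> has
    squared norm 1 and that of \<open>?B\<close> at least 1, which gives
    \<open>1 / w \<ge> 1 / w'\<close>. A sink of the graph of \<open>C'\<close> gives the
    reverse.\<close>
  show "w = w'"
  proof (rule antisym)
    obtain p where p: "p \<in> {..<n}" "\<And>q. q \<in> {..<n} \<Longrightarrow> (node_of L K p, node_of L K q) \<notin> node_graph P L K C"
      using node_graph_sink[OF acyc(1) npos] by metis
    have "(\<Sum>k<n. ?A $$ (p, k) * ?A $$ (p, k)) = 1"
      using p C0 diag by (intro sink_eq) auto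
    then have "1 / w \<ge> 1 / w'"
      using sums[of p p] p(1) one_le[of ?B p] diag(2)[of p] w by (simp add: divide_right_mono)
    then show "w \<le> w'" using w by (simp add: field_simps)
    obtain p where p: "p \<in> {..<n}" "\<And>q. q \<in> {..<n} \<Longrightarrow> (node_of L K p, node_of L K q) \<notin> node_graph P L K C'"
      using node_graph_sink[OF acyc(2) npos] by metis
    have "(\<Sum>k<n. ?B $$ (p, k) * ?B $$ (p, k)) = 1"
      using p D0 diag D by (intro sink_eq) auto
    then have "1 / w' \<ge> 1 / w"
      using sums[of p p, symmetric] p(1) one_le[of ?A p] diag(1)[of p] w by (simp add: divide_right_mono)
    then show "w' \<le> w" using w by (simp add: field_simps)
  qed
  \<comment> \<open>The graph of \<open>C\<close> supplies the sinks of \<open>?A\<close>, and with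
    equal variances the scaled sums become a plain Gram identity.\<close>
  have AB: "?A $$ (p, q) = ?B $$ (p, q)" if "p < n" "q < n" for p q
  proof (rule gram_unit_diagonal_unique[of "{..<n}" "\<lambda>p q. ?A $$ (p, q)" "\<lambda>p q. ?B $$ (p, q)"])
    fix U assume U: "U \<subseteq> {..<n}" "U \<noteq> {}"
    obtain p where p: "p \<in> U" "\<And>q. q \<in> U \<Longrightarrow> (node_of L K p, node_of L K q) \<notin> node_graph P L K C"
      using node_graph_sink[OF acyc(1) U(2)] by metis
    then show "\<exists>p\<in>U. \<forall>q\<in>U. q \<noteq> p \<longrightarrow> ?A $$ (p, q) = 0"
      using U(1) C0 by (intro bexI[of _ p]) (auto simp: subset_iff)
  next
    fix p q assume "p \<in> {..<n}" "q \<in> {..<n}"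
    then show "(\<Sum>k<n. ?A $$ (p, k) * ?A $$ (q, k)) = (\<Sum>k<n. ?B $$ (p, k) * ?B $$ (q, k))"
      using sums[of p q] w unfolding \<open>w = w'\<close> by simp
  qed (use that diag in auto)
  show "C = ?D"
  proof (rule eq_matI)
    fix p q assume "p < dim_row ?D" "q < dim_col ?D"
    then show "C $$ (p, q) = ?D $$ (p, q)" using AB[of p q] D by simp
  qed simp_all
qed

section \<open>Identification of the parameters in the equivalence class\<close>

theorem theorem1:
  fixes P T :: nat and L K :: "nat \<Rightarrow> nat" and \<Theta>star :: param and \<eta> :: real
  assumes pos: "P > 0" "T > 0" "\<And>j. j < P \<Longrightarrow> L j > 0" "\<And>j. j < P \<Longrightarrow> K j > 0"
    and adm: "admissible P T L K \<Theta>star"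
    and eta: "\<eta> > 0"
    and eig: "\<And>e. eigenvalue (cov_x P L K \<Theta>star) e \<Longrightarrow> e > \<eta>"
    and KT: "\<And>j. j < P \<Longrightarrow> K j < T"
  shows "\<forall>\<Theta> \<in> equiv_class P T L K \<Theta>star.
    \<exists>Q :: nat \<Rightarrow> real mat.
      (\<forall>j<P. Q j \<in> carrier_mat (K j) (K j) \<and>
         transpose_mat (Q j) * Q j = 1\<^sub>m (K j) \<and> Q j * transpose_mat (Q j) = 1\<^sub>m (K j)) \<and>
      (\<forall>j<P. \<forall>j'<P. \<forall>l<L j. \<forall>l'<L j'.
         basis \<Theta> j = basis \<Theta>star j * Q j \<and>
         noise_var \<Theta> j l = noise_var \<Theta>star j l \<and>
         innov_var \<Theta> = innov_var \<Theta>star \<and>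
         fun_block L K (coef \<Theta>) j' l' j l =
           transpose_mat (Q j') * fun_block L K (coef \<Theta>star) j' l' j l * Q j)"
proof
  fix \<Theta> assume "\<Theta> \<in> equiv_class P T L K \<Theta>star"
  then have adm0: "admissible P T L K \<Theta>" and covY: "cov_Y P T L K \<Theta> = cov_Y P T L K \<Theta>star"
    by (auto simp: equiv_class_def)
  let ?n = "x_dim P L K" and ?S = "cov_x P L K \<Theta>" and ?S' = "cov_x P L K \<Theta>star"
  let ?G = "(1 / sqrt (innov_var \<Theta>)) \<cdot>\<^sub>m (1\<^sub>m ?n - coef \<Theta>)"
  obtain F where F: "F \<in> carrier_mat ?n ?n" "?S = transpose_mat F * F" "F * ?G = 1\<^sub>m ?n"
    using cov_x_factor[OF adm0] .
  obtain F' where F': "F' \<in> carrier_mat ?n ?n" "?S' = transpose_mat F' * F'"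
    "F' * ((1 / sqrt (innov_var \<Theta>star)) \<cdot>\<^sub>m (1\<^sub>m ?n - coef \<Theta>star)) = 1\<^sub>m ?n"
    using cov_x_factor[OF adm] .
  have C: "coef \<Theta> \<in> carrier_mat ?n ?n" "coef \<Theta>star \<in> carrier_mat ?n ?n"
    and acyc: "acyclic (node_graph P L K (coef \<Theta>))" "acyclic (node_graph P L K (coef \<Theta>star))"
    and w: "innov_var \<Theta> > 0" "innov_var \<Theta>star > 0"
    using adm0 adm by (auto simp: admissible_def)
  have B: "basis \<Theta> j \<in> carrier_mat T (K j)" "transpose_mat (basis \<Theta> j) * basis \<Theta> j = 1\<^sub>m (K j)"
    and B': "basis \<Theta>star j \<in> carrier_mat T (K j)"
      "transpose_mat (basis \<Theta>star j) * basis \<Theta>star j = 1\<^sub>m (K j)" if "j < P" for j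
    using adm0 adm that by (auto simp: admissible_def)
  have S: "?S \<in> carrier_mat ?n ?n" "?S' \<in> carrier_mat ?n ?n" using F F' by auto
  have G: "?G \<in> carrier_mat ?n ?n" using C by (intro smult_carrier_mat minus_carrier_mat)
  have GF: "?G * F = 1\<^sub>m ?n" using mat_mult_left_right_inverse[OF F(1) G F(3)] .
  \<comment> \<open>Presents diagonal blocks of the covariance as Gram matrices, the form in which
    noise and basis are recovered.\<close>
  have gram: "fun_block L K (transpose_mat H * H) j l j l =
      transpose_mat (H * embed_mat P L K j l) * (H * embed_mat P L K j l)"
    if H: "H \<in> carrier_mat ?n ?n" and j: "j < P" "l < L j" for H j l
  proof -
    note [simp] = carrier_matD[OF H] carrier_matD[OF embed_mat_carrier[of P L K j l]]
    have "transpose_mat H * H \<in> carrier_mat ?n ?n" by (auto intro: carrier_matI)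
    then show ?thesis
      using j by (simp add: fun_block_eq_embed[where P = P] transpose_mult[OF H embed_mat_carrier] mult_assoc_dim)
  qed
  have XE: "H * embed_mat P L K j l \<in> carrier_mat ?n (K j)" if "H \<in> carrier_mat ?n ?n" for H j l
    using that by (rule mult_carrier_mat) simp
  have fb: "fun_block L K A j l j' l' \<in> carrier_mat (K j) (K j')" for A :: "real mat" and j l j' l'
    by (simp add: fun_block_def)
  note blocks = cov_Y_block_eq[OF covY adm0 adm]
  have noise: "noise_var \<Theta> j l = noise_var \<Theta>star j l" if j: "j < P" "l < L j" for j l
  proof -
    have eq: "basis \<Theta> j * (transpose_mat (F * embed_mat P L K j l) * (F * embed_mat P L K j l)) *
        transpose_mat (basis \<Theta> j) + noise_var \<Theta> j l \<cdot>\<^sub>m 1\<^sub>m T =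
      basis \<Theta>star j * (transpose_mat (F' * embed_mat P L K j l) * (F' * embed_mat P L K j l)) *
        transpose_mat (basis \<Theta>star j) + noise_var \<Theta>star j l \<cdot>\<^sub>m 1\<^sub>m T"
      using blocks[OF j(1) j(1) j(2) j(2)] gram[OF F(1) j] gram[OF F'(1) j]
      by (simp add: cov_Y_block_def F(2) F'(2))
    show ?thesis
      using low_rank_noise_le[OF B(1)[OF j(1)] B'(1)[OF j(1)] KT[OF j(1)] XE[OF F(1)] XE[OF F'(1)] eq]
        low_rank_noise_le[OF B'(1)[OF j(1)] B(1)[OF j(1)] KT[OF j(1)] XE[OF F'(1)] XE[OF F(1)] eq[symmetric]]
      by simp
  qed
  have signal: "basis \<Theta> j * fun_block L K ?S j l j' l' * transpose_mat (basis \<Theta> j') =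
      basis \<Theta>star j * fun_block L K ?S' j l j' l' * transpose_mat (basis \<Theta>star j')"
    if j: "j < P" "j' < P" "l < L j" "l' < L j'" for j l j' l'
  proof (cases "(j, l) = (j', l')")
    case True
    have c: "D * X * transpose_mat D \<in> carrier_mat T T" if "D \<in> carrier_mat T (K j)" for D X :: "real mat"
      using that by (auto intro: carrier_matI)
    have eq: "j' = j" "l' = l" using True by simp_all
    show ?thesis
      unfolding eq
      \<comment> \<open>Only diagonal blocks carry noise, and since the variances agree it
        cancels.\<close>
      by (rule mat_add_right_cancel[OF c c, where C = "noise_var \<Theta> j l \<cdot>\<^sub>m 1\<^sub>m T"])
        (use blocks[OF j(1,1,3,3)] noise[OF j(1,3)] B(1)[OF j(1)] B'(1)[OF j(1)] in \<open>auto simp: cov_Y_block_def\<close>)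
  next
    case False
    then show ?thesis using blocks[OF j] by (auto simp: cov_Y_block_def)
  qed
  define Q where "Q j = transpose_mat (basis \<Theta>star j) * basis \<Theta> j" for j
  have Qc: "Q j \<in> carrier_mat (K j) (K j)" if "j < P" for j
    using B(1)[OF that] B'(1)[OF that] by (auto simp: Q_def)
  \<comment> \<open>Function 0 of node \<open>j\<close> exists because \<open>L j\<close> is
    positive. The matrix \<open>F * ?E\<close> has the left inverse
    \<open>transpose_mat ?E * ?G\<close>, as \<open>?G\<close> inverts \<open>F\<close> and
    \<open>?E\<close> has orthonormal columns.\<close>
  have basis: "basis \<Theta> j = basis \<Theta>star j * Q j" if j: "j < P" for j
  proof -
    let ?E = "embed_mat P L K j 0"
    note [simp] = carrier_matD[OF F(1)] carrier_matD[OF G] carrier_matD[OF embed_mat_carrier[of P L K j 0]]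
    have tEG: "transpose_mat ?E * ?G \<in> carrier_mat (K j) ?n"
      by (rule mult_carrier_mat[OF _ G]) simp
    have "transpose_mat ?E * ?G * (F * ?E) = transpose_mat ?E * ((?G * F) * ?E)"
      using C by (simp add: mult_assoc_dim)
    also have "\<dots> = 1\<^sub>m (K j)"
      unfolding GF using embed_mat_orth[of j P 0 L K] pos(3)[OF j] j
      by (simp add: left_mult_one_mat[OF embed_mat_carrier])
    finally have inv: "transpose_mat ?E * ?G * (F * ?E) = 1\<^sub>m (K j)" .
    show ?thesis
      unfolding Q_def
      using signal[OF j j pos(3)[OF j] pos(3)[OF j]] gram[OF F(1) j pos(3)[OF j]]
      by (intro basis_transfer[OF B(1)[OF j] B'(1)[OF j] B(2)[OF j] B'(2)[OF j] XE[OF F(1)] tEG inv fb[of ?S' j 0 j 0]])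
        (simp add: F(2))
  qed
  have QQ: "transpose_mat (Q j) * Q j = 1\<^sub>m (K j)" if j: "j < P" for j
  proof -
    note [simp] = carrier_matD[OF B(1)[OF j]] carrier_matD[OF B'(1)[OF j]]
    \<comment> \<open>Only one factor is expanded: \<open>basis\<close> turns the remaining
      \<open>basis \<Theta>star j * Q j\<close> back into \<open>basis \<Theta> j\<close>, whose
      columns are orthonormal.\<close>
    have "transpose_mat (Q j) * Q j = transpose_mat (basis \<Theta> j) * (basis \<Theta>star j * Q j)"
      using transpose_mult[of "transpose_mat (basis \<Theta>star j)" "K j" T "basis \<Theta> j" "K j"] B(1)[OF j] B'(1)[OF j]
      by (simp add: Q_def mult_assoc_dim)
    then show ?thesis using basis[OF j] B(2)[OF j] by simp
  qed
  let ?R = "block_rotation P L K Q"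
  have cov: "?S = transpose_mat ?R * ?S' * ?R"
  proof (rule mat_eq_by_fun_blocks[OF S(1)])
    show "transpose_mat ?R * ?S' * ?R \<in> carrier_mat ?n ?n"
      using S(2) by (intro mult_carrier_mat[where n = ?n]) simp_all
    fix j l j' l' assume j: "j < P" "l < L j" "j' < P" "l' < L j'"
    have "fun_block L K ?S j l j' l' = transpose_mat (Q j) * fun_block L K ?S' j l j' l' * Q j'"
      unfolding Q_def
      by (rule coeff_cov_transfer[OF B(1)[OF j(1)] B(1)[OF j(3)] B'(1)[OF j(1)] B'(1)[OF j(3)] fb fb
            B(2)[OF j(1)] B(2)[OF j(3)] signal[OF j(1,3,2,4)]])
    also have "\<dots> = fun_block L K (transpose_mat ?R * ?S' * ?R) j l j' l'"
      using S(2) j by (intro fun_block_rotation[symmetric] Qc)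
    finally show "fun_block L K ?S j l j' l' = fun_block L K (transpose_mat ?R * ?S' * ?R) j l j' l'" .
  qed
  note unique = coef_unique_up_to_rotation[OF pos(1) pos(3)[OF pos(1)] pos(4)[OF pos(1)] Qc QQ C acyc w
      F(1,3) F'(1,3) cov[unfolded F(2) F'(2)]]
  have "fun_block L K (coef \<Theta>) j' l' j l = transpose_mat (Q j') * fun_block L K (coef \<Theta>star) j' l' j l * Q j"
    if "j' < P" "l' < L j'" "j < P" "l < L j" for j' l' j l
    using fun_block_rotation[OF Qc C(2) that] unique(2) by simp
  moreover have "Q j * transpose_mat (Q j) = 1\<^sub>m (K j)" if "j < P" for j
    using mat_mult_left_right_inverse[of "transpose_mat (Q j)" "K j" "Q j"] Qc[OF that] QQ[OF that] by simp
  ultimately show "\<exists>Q. (\<forall>j<P. Q j \<in> carrier_mat (K j) (K j) \<and>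
         transpose_mat (Q j) * Q j = 1\<^sub>m (K j) \<and> Q j * transpose_mat (Q j) = 1\<^sub>m (K j)) \<and>
      (\<forall>j<P. \<forall>j'<P. \<forall>l<L j. \<forall>l'<L j'.
         basis \<Theta> j = basis \<Theta>star j * Q j \<and>
         noise_var \<Theta> j l = noise_var \<Theta>star j l \<and>
         innov_var \<Theta> = innov_var \<Theta>star \<and>
         fun_block L K (coef \<Theta>) j' l' j l =
           transpose_mat (Q j') * fun_block L K (coef \<Theta>star) j' l' j l * Q j)"
    using Qc QQ basis noise unique(1) by (intro exI[of _ Q]) blast
qed

end
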